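(* (1) For every integer $k\ge 2$ there is a homomorphism $\mathrm{SG}(2k+2,k)\to S_4$. (2) For every positive integer $k$ there is no homomorphism $\mathrm{KG}(2k+2,k)\to S_4$.
   Context: The Kneser graph $\mathrm{KG}(n,k)$ ($n\ge 2k$) has as vertices all $k$-element subsets of $[n]=\{1,\dots,n\}$, two being adjacent iff they are disjoint. The Schrijver graph $\mathrm{SG}(n,k)$ is the induced subgraph of $\mathrm{KG}(n,k)$ on the stable $k$-subsets, i.e., those $A$ containing no pair $\{i,i+1\}$ for $i\in[n-1]$ and not containing both $1$ and $n$. The symmetric shift graph $S_m$ has vertex set $\{(i,j):1\le i,j\le m,\ i\ne j\}$, and $(i,j)$ is adjacent to $(k,\ell)$ iff $j=k$ or $i=\ell$. A homomorphism is an edge-preserving map between vertex sets. *)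

theory Defs
  imports Main
begin

definition kneser_vertices :: "nat \<Rightarrow> nat \<Rightarrow> nat set set" where
  "kneser_vertices n k = {A. A \<subseteq> {1..n} \<and> card A = k}"

definition kneser_adj :: "nat set \<Rightarrow> nat set \<Rightarrow> bool" where
  "kneser_adj A B \<longleftrightarrow> A \<inter> B = {}"

definition stable_set :: "nat \<Rightarrow> nat set \<Rightarrow> bool" where
  "stable_set n A \<longleftrightarrow>
     (\<forall>i\<in>{1..<n}. \<not> (i \<in> A \<and> Suc i \<in> A)) \<and> \<not> (1 \<in> A \<and> n \<in> A)"

definition schrijver_vertices :: "nat \<Rightarrow> nat \<Rightarrow> nat set set" where
  "schrijver_vertices n k = {A \<in> kneser_vertices n k. stable_set n A}"

definition shift_vertices :: "nat \<Rightarrow> (nat \<times> nat) set" where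
  "shift_vertices m = {(i, j). i \<in> {1..m} \<and> j \<in> {1..m} \<and> i \<noteq> j}"

definition shift_adj :: "nat \<times> nat \<Rightarrow> nat \<times> nat \<Rightarrow> bool" where
  "shift_adj p q \<longleftrightarrow> snd p = fst q \<or> fst p = snd q"

definition graph_hom ::
  "'a set \<Rightarrow> ('a \<Rightarrow> 'a \<Rightarrow> bool) \<Rightarrow> 'b set \<Rightarrow> ('b \<Rightarrow> 'b \<Rightarrow> bool) \<Rightarrow> ('a \<Rightarrow> 'b) \<Rightarrow> bool" where
  "graph_hom V E W F f \<longleftrightarrow>
     (\<forall>x\<in>V. f x \<in> W) \<and> (\<forall>x\<in>V. \<forall>y\<in>V. E x y \<longrightarrow> F (f x) (f y))"

end

theory Submission
  imports Defs
begin

text \<open>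
  For (1), deleting the maximum maps \<open>SG(n+2,k+1)\<close> to \<open>SG(n,k)\<close>, so it suffices to map
  \<open>SG(6,2)\<close> to \<open>S\<^sub>4\<close>.

  For (2), let \<open>f\<close> be a homomorphism and colour each vertex by the first coordinate of its image, which
  is a proper 4-colouring. Put \<open>n = 2k+2\<close> and give a signed subset of \<open>[n]\<close> the sign of its least
  element if it has at most \<open>2k-2\<close> elements, and otherwise the sign of the side containing the
  \<open>k\<close>-subset of largest colour. By a parity form of Ky Fan's lemma the number of maximal flags with
  signs \<open>+, -, +, \<dots>\<close> is odd. Such a flag passes through disjoint \<open>(k-1)\<close>-sets \<open>A\<close>, \<open>B\<close> and then adds
  the four remaining elements \<open>w, x, y, z\<close> to \<open>A, B, A, B\<close>, the largest colours becoming 1, 2, 3, 4 in turn.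
  For fixed \<open>A\<close>, \<open>B\<close>, exchanging \<open>w\<close> with \<open>y\<close> or \<open>x\<close> with \<open>z\<close> cancels in pairs all orders except those where
  \<open>A \<union> {w}, B \<union> {x}, A \<union> {y}, B \<union> {z}\<close> have colours 1, 2, 3, 4. Their images form one of the two
  4-cycles \<open>(1,2), (2,3), (3,4), (4,1)\<close> and \<open>(1,4), (2,1), (3,2), (4,3)\<close> of \<open>S\<^sub>4\<close>, and a finite check shows
  that the number of these orders is even as well, a contradiction.
\<close>

section \<open>Parity of the number of alternating flags\<close>

lemma even_card_iff_even_card_fixpoints:
  assumes "finite A" "\<And>x. x \<in> A \<Longrightarrow> g x \<in> A" "\<And>x. x \<in> A \<Longrightarrow> g (g x) = x"
  shows "even (card A) \<longleftrightarrow> even (card {x \<in> A. g x = x})"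
  using assms
proof (induction "card A" arbitrary: A rule: less_induct)
  case less
  show ?case
  proof (cases "\<exists>x\<in>A. g x \<noteq> x")
    case True
    then obtain x where x: "x \<in> A" "g x \<noteq> x" by blast
    define B where "B = A - {x, g x}"
    have gx: "g x \<in> A" "g (g x) = x" using less.prems x by auto
    have card: "card A = card B + 2"
    proof -
      have "card {x, g x} \<le> card A" using x gx less.prems by (intro card_mono) auto
      then show ?thesis
        unfolding B_def using x gx less.prems by (subst card_Diff_subset) auto
    qed
    have clB: "g y \<in> B" if "y \<in> B" for y
      using that less.prems(2,3) unfolding B_def by (metis DiffE DiffI insertCI insertE singletonD gx(2))
    have "even (card B) \<longleftrightarrow> even (card {x \<in> B. g x = x})"
      using less.prems clB card by (intro less.hyps) (auto simp: B_def)
    moreover have "{x \<in> B. g x = x} = {x \<in> A. g x = x}" using x gx by (auto simp: B_def)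
    ultimately show ?thesis using card by simp
  next
    case False
    then have "{x \<in> A. g x = x} = A" by blast
    then show ?thesis by simp
  qed
qed

lemma even_card_if_even_fibres:
  assumes "finite A" "\<And>y. y \<in> h ` A \<Longrightarrow> even (card {x \<in> A. h x = y})"
  shows "even (card A)"
proof -
  have "card A = (\<Sum>y\<in>h ` A. card {x \<in> A. h x = y})"
    using sum.image_gen[OF assms(1), of "\<lambda>_. 1::nat" h] by simp
  then show ?thesis using assms by (simp add: dvd_sum)
qed

text \<open>If \<open>I\<close> is nonempty, then \<open>t\<close> is a block of \<open>True\<close>
  followed by a block of \<open>False\<close>. With \<open>a\<close> the length of the first block,
  the admissible positions are \<open>a - 1\<close> and \<open>a\<close>. Both lie in
  \<open>{0..n}\<close> unless \<open>t\<close> is constant there, and then exactly one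
  does.\<close>

lemma odd_card_cut_positions:
  fixes t :: "nat \<Rightarrow> bool" and n :: nat
  defines "I \<equiv> {i. i \<le> n \<and> (\<forall>j\<le>n. (j < i \<longrightarrow> t j) \<and> (i < j \<longrightarrow> \<not> t j))}"
  shows "odd (card I) \<longleftrightarrow> (\<forall>j\<le>n. t j) \<or> (\<forall>j\<le>n. \<not> t j)"
proof (cases "I = {}")
  case True
  have "n \<in> I" if "\<forall>j\<le>n. t j" using that by (auto simp: I_def)
  moreover have "0 \<in> I" if "\<forall>j\<le>n. \<not> t j" using that by (auto simp: I_def)
  ultimately show ?thesis using True by auto
next
  case False
  then obtain i where i: "i \<le> n" "\<And>j. j < i \<Longrightarrow> t j" "\<And>j. i < j \<Longrightarrow> j \<le> n \<Longrightarrow> \<not> t j"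
    by (auto simp: I_def)
  define a where "a = (if t i then Suc i else i)"
  have a: "a \<le> Suc n" "\<And>j. j < a \<Longrightarrow> t j" "\<And>j. a \<le> j \<Longrightarrow> j \<le> n \<Longrightarrow> \<not> t j"
    using i by (auto simp: a_def less_Suc_eq Suc_le_eq le_less split: if_splits)
  have I: "I = {l. l \<le> n \<and> (l = a \<or> Suc l = a)}"
  proof (intro set_eqI iffI)
    fix l assume "l \<in> I"
    then have l: "l \<le> n" "\<And>j. j < l \<Longrightarrow> t j" "\<And>j. l < j \<Longrightarrow> j \<le> n \<Longrightarrow> \<not> t j"
      by (auto simp: I_def)
    have "l \<le> a" using l(1) l(2)[of a] a(3)[of a] by force
    moreover have "a \<le> Suc l" using l(3)[of "Suc l"] a(1) a(2)[of "Suc l"] by force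
    ultimately show "l \<in> {l. l \<le> n \<and> (l = a \<or> Suc l = a)}" using l(1) by auto
  qed (use a in \<open>auto simp: I_def\<close>)
  consider "a = 0" | "a = Suc n" | m where "a = Suc m" "m < n"
    using a(1) by (cases a) force+
  then show ?thesis
  proof cases
    case 1
    then have "I = {0}" using I by auto
    then show ?thesis using a 1 by auto
  next
    case 2
    then have "I = {n}" using I by auto
    then show ?thesis using a 2 by auto
  next
    case 3
    then have "I = {m, Suc m}" using I by auto
    then have "even (card I)" by simp
    moreover have "t 0" "\<not> t n" using a(2)[of 0] a(3)[of n] 3 by auto
    ultimately show ?thesis by blast
  qed
qed

text \<open>A signed set is encoded as the set of its (element, sign) pairs. A list stands for the maximal
  flag of signed sets formed by the nonempty prefixes.\<close>
definition signed_flags :: "nat \<Rightarrow> (nat \<times> bool) list set" where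
  "signed_flags n = {xs. distinct (map fst xs) \<and> fst ` set xs = {1..n}}"

definition alternating_flags :: "((nat \<times> bool) set \<Rightarrow> bool) \<Rightarrow> nat \<Rightarrow> (nat \<times> bool) list set" where
  "alternating_flags \<sigma> n = {xs \<in> signed_flags n. \<forall>i<n. \<sigma> (set (take (Suc i) xs)) = even i}"

lemma length_signed_flag:
  assumes "xs \<in> signed_flags n"
  shows "length xs = n"
proof -
  have "length xs = card (set (map fst xs))"
    using assms distinct_card[of "map fst xs"] by (simp add: signed_flags_def)
  then show ?thesis using assms by (simp add: signed_flags_def)
qed

lemma flag_nth_fresh:
  assumes "xs \<in> signed_flags n" "i < n"
  shows "fst (xs ! i) \<notin> fst ` set (take i xs)"
proof
  have d: "distinct (map fst xs)" and l: "length xs = n"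
    using assms length_signed_flag by (auto simp: signed_flags_def)
  assume "fst (xs ! i) \<in> fst ` set (take i xs)"
  then obtain j where "j < i" "fst (xs ! i) = fst (xs ! j)"
    using assms(2) l by (auto simp: in_set_conv_nth)
  then show False using d l assms(2) nth_eq_iff_index_eq[of "map fst xs" i j] by simp
qed

lemma set_take_Suc:
  assumes "i < length xs"
  shows "set (take (Suc i) xs) = insert (xs ! i) (set (take i xs))"
  using assms by (simp add: take_Suc_conv_app_nth)

lemma finite_signed_flags: "finite (signed_flags n)"
proof (rule finite_subset)
  show "signed_flags n \<subseteq> {xs. set xs \<subseteq> {1..n} \<times> UNIV \<and> length xs = n}"
    using length_signed_flag by (force simp: signed_flags_def)
qed (simp add: finite_lists_length_eq)

text \<open>Nonempty signed sets over \<open>{1..n}\<close> are the proper nonempty faces of the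
  n-dimensional cross-polytope, and \<open>apsnd Not\<close> is its antipodal map. The condition
  \<open>inj_on fst x\<close> forbids an element with both signs.\<close>

definition antipodal :: "((nat \<times> bool) set \<Rightarrow> bool) \<Rightarrow> nat \<Rightarrow> bool" where
  "antipodal \<sigma> n \<longleftrightarrow> (\<forall>x. x \<noteq> {} \<longrightarrow> finite x \<longrightarrow> inj_on fst x \<longrightarrow> fst ` x \<subseteq> {1..n} \<longrightarrow>
     \<sigma> (apsnd Not ` x) = (\<not> \<sigma> x))"

lemma antipodal_flag:
  assumes "antipodal \<sigma> n" "xs \<in> signed_flags n" "i < n"
  shows "\<sigma> (set (take (Suc i) (map (apsnd Not) xs))) = (\<not> \<sigma> (set (take (Suc i) xs)))"
proof -
  have "xs \<noteq> []" using length_signed_flag[OF assms(2)] assms(3) by auto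
  then have "set (take (Suc i) xs) \<noteq> {}" by simp
  moreover have "inj_on fst (set (take (Suc i) xs))"
    using assms(2) set_take_subset[of "Suc i" xs]
    by (auto simp: signed_flags_def distinct_map intro: inj_on_subset)
  moreover have "fst ` set (take (Suc i) xs) \<subseteq> {1..n}"
    using assms(2) set_take_subset[of "Suc i" xs] by (auto simp: signed_flags_def)
  ultimately show ?thesis
    using assms(1) by (simp add: antipodal_def take_map)
qed

lemma map_negate_flag:
  assumes "xs \<in> signed_flags n"
  shows "map (apsnd Not) xs \<in> signed_flags n"
  using assms by (auto simp: signed_flags_def image_image comp_def)

lemma map_apsnd_Not_idem: "map (apsnd Not) (map (apsnd Not) xs) = (xs :: (nat \<times> bool) list)"
  by (simp add: comp_def apsnd_def map_prod_def case_prod_beta)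

section \<open>Exchanging neighbouring entries of a flag\<close>

abbreviation swap_at :: "nat \<Rightarrow> 'a list \<Rightarrow> 'a list" where
  "swap_at i xs \<equiv> xs[i := xs ! Suc i, Suc i := xs ! i]"

text \<open>Every prefix except the one ending at position \<open>i\<close> contains both exchanged
  entries or neither. The swap therefore replaces only member \<open>i\<close> of the flag.\<close>

lemma set_take_swap_at:
  assumes "Suc i < length xs" "j \<noteq> i"
  shows "set (take (Suc j) (swap_at i xs)) = set (take (Suc j) xs)"
proof (cases "j < i")
  case True
  then show ?thesis by simp
next
  case False
  then have "i < j" using assms by simp
  then have "take (Suc j) (swap_at i xs) = swap_at i (take (Suc j) xs)"
    by (simp add: take_update_swap)
  then show ?thesis
    using assms \<open>i < j\<close> by (metis length_take min_less_iff_conj not_less_eq set_swap Suc_lessD less_Suc_eq)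
qed

lemma swap_at_flag:
  assumes "xs \<in> signed_flags n" "Suc i < n"
  shows "swap_at i xs \<in> signed_flags n" "swap_at i xs \<noteq> xs" "set (swap_at i xs) = set xs"
    "swap_at i (swap_at i xs) = xs"
proof -
  have l: "length xs = n" using assms length_signed_flag by blast
  show s: "set (swap_at i xs) = set xs" using l assms set_swap[of i xs "Suc i"] by simp
  have "map fst (swap_at i xs) = swap_at i (map fst xs)"
    using l assms by (simp add: map_update)
  then have "distinct (map fst (swap_at i xs))"
    using assms l distinct_swap[of i "map fst xs" "Suc i"] by (simp add: signed_flags_def)
  then show "swap_at i xs \<in> signed_flags n" using s assms by (simp add: signed_flags_def)
  have "distinct xs" using assms by (simp add: signed_flags_def distinct_map)
  then have "xs ! i \<noteq> xs ! Suc i" using l assms by (simp add: nth_eq_iff_index_eq)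
  moreover have "swap_at i xs ! i = xs ! Suc i" using l assms by simp
  ultimately show "swap_at i xs \<noteq> xs" by metis
  show "swap_at i (swap_at i xs) = xs"
    using l assms by (intro nth_equalityI) (auto simp: nth_list_update)
qed

text \<open>Deleting the \<open>i\<close>-th member of the flag leaves a chain with signs \<open>+, -, +, \<dots>\<close>.\<close>
definition near_alternating :: "((nat \<times> bool) set \<Rightarrow> bool) \<Rightarrow> nat \<Rightarrow> (nat \<times> bool) list \<Rightarrow> nat \<Rightarrow> bool" where
  "near_alternating \<sigma> n xs i \<longleftrightarrow> i \<le> n \<and>
     (\<forall>j\<le>n. (j < i \<longrightarrow> \<sigma> (set (take (Suc j) xs)) = even j) \<and>
            (i < j \<longrightarrow> \<sigma> (set (take (Suc j) xs)) = odd j))"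

lemma odd_card_near_alternating:
  "odd (card {i. near_alternating \<sigma> n xs i}) \<longleftrightarrow>
     (\<forall>j\<le>n. \<sigma> (set (take (Suc j) xs)) = even j) \<or> (\<forall>j\<le>n. \<sigma> (set (take (Suc j) xs)) = odd j)"
  using odd_card_cut_positions[of n "\<lambda>j. \<sigma> (set (take (Suc j) xs)) = even j"]
  by (simp add: near_alternating_def)

lemma near_alternating_cong:
  assumes "\<And>j. j \<le> n \<Longrightarrow> j \<noteq> i \<Longrightarrow> set (take (Suc j) ys) = set (take (Suc j) xs)"
  shows "near_alternating \<sigma> n ys i \<longleftrightarrow> near_alternating \<sigma> n xs i"
  using assms by (auto simp: near_alternating_def)

section \<open>The induction step of the parity form of Ky Fan's lemma\<close>

lemma signed_flags_snoc:
  "xs @ [(Suc n, b)] \<in> signed_flags (Suc n) \<longleftrightarrow> xs \<in> signed_flags n"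
proof -
  have "Suc n \<notin> fst ` set xs \<and> insert (Suc n) (fst ` set xs) = insert (Suc n) {1..n} \<longleftrightarrow> fst ` set xs = {1..n}"
    (is "?L \<longleftrightarrow> ?R")
  proof
    assume ?L
    then show ?R using insert_ident[of "Suc n" "fst ` set xs" "{1..n}"] by (meson atLeastAtMost_iff not_less_eq_eq order_refl)
  next
    assume ?R
    then show ?L by simp
  qed
  then show ?thesis by (auto simp: signed_flags_def atLeastAtMostSuc_conv)
qed

lemma flip_last_flag:
  assumes "ys @ [(a, b)] \<in> signed_flags n"
  shows "ys @ [(a, \<not> b)] \<in> signed_flags n"
  using assms by (auto simp: signed_flags_def)

text \<open>Negating all signs turns an alternating flag with \<open>Suc n\<close> negative into a
  flag with \<open>Suc n\<close> positive and signs -, +, -, and so on. Admitting both sign patterns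
  among the flags with \<open>Suc n\<close> positive thus counts every alternating flag
  once.\<close>

lemma card_alternating_flags_Suc:
  assumes "antipodal \<sigma> (Suc n)"
  shows "card (alternating_flags \<sigma> (Suc n)) = card {xs \<in> signed_flags (Suc n). (Suc n, True) \<in> set xs \<and>
      ((\<forall>j\<le>n. \<sigma> (set (take (Suc j) xs)) = even j) \<or> (\<forall>j\<le>n. \<sigma> (set (take (Suc j) xs)) = odd j))}"
    (is "_ = card ?R")
proof -
  define pos where "pos xs \<longleftrightarrow> (\<forall>j\<le>n. \<sigma> (set (take (Suc j) xs)) = even j)" for xs
  define neg where "neg xs \<longleftrightarrow> (\<forall>j\<le>n. \<sigma> (set (take (Suc j) xs)) = odd j)" for xs
  let ?F = "signed_flags (Suc n)"
  let ?top = "\<lambda>b xs. (Suc n, b) \<in> set xs"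
  have fin: "finite {xs \<in> ?F. Q xs}" for Q using finite_signed_flags by simp
  have top: "?top False xs \<longleftrightarrow> \<not> ?top True xs" if "xs \<in> ?F" for xs
  proof -
    have "Suc n \<in> fst ` set xs" "inj_on fst (set xs)"
      using that by (auto simp: signed_flags_def distinct_map)
    then obtain b where b: "(Suc n, b) \<in> set xs" by force
    moreover have "c = b" if "(Suc n, c) \<in> set xs" for c
      using inj_onD[OF \<open>inj_on fst (set xs)\<close> _ that b] by simp
    ultimately show ?thesis by (cases b) auto
  qed
  have negate: "neg (map (apsnd Not) xs) \<longleftrightarrow> pos xs" "pos (map (apsnd Not) xs) \<longleftrightarrow> neg xs" if "xs \<in> ?F" for xs
    using antipodal_flag[OF assms that] by (auto simp: pos_def neg_def less_Suc_eq_le)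
  have topneg: "?top True (map (apsnd Not) xs) \<longleftrightarrow> ?top False xs" for xs :: "(nat \<times> bool) list"
    by (force simp: apsnd_def)
  have inj: "inj_on (map (apsnd Not)) X" for X :: "(nat \<times> bool) list set"
    by (metis inj_on_inverseI map_apsnd_Not_idem)
  have "map (apsnd Not) ` {xs \<in> ?F. ?top False xs \<and> pos xs} = {xs \<in> ?F. ?top True xs \<and> neg xs}"
  proof (intro equalityI subsetI)
    fix ys assume "ys \<in> {xs \<in> ?F. ?top True xs \<and> neg xs}"
    then have ys: "ys \<in> ?F" "?top True ys" "neg ys" by simp_all
    have "?top False (map (apsnd Not) ys)" using topneg[of "map (apsnd Not) ys"] ys(2)
      by (simp only: map_apsnd_Not_idem)
    then have "map (apsnd Not) ys \<in> {xs \<in> ?F. ?top False xs \<and> pos xs}"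
      using ys negate(2) map_negate_flag by blast
    then show "ys \<in> map (apsnd Not) ` {xs \<in> ?F. ?top False xs \<and> pos xs}"
      by (rule image_eqI[rotated]) (rule map_apsnd_Not_idem[symmetric])
  next
    fix ys assume "ys \<in> map (apsnd Not) ` {xs \<in> ?F. ?top False xs \<and> pos xs}"
    then obtain xs where "ys = map (apsnd Not) xs" "xs \<in> ?F" "?top False xs" "pos xs" by blast
    then show "ys \<in> {xs \<in> ?F. ?top True xs \<and> neg xs}"
      using negate(1) topneg map_negate_flag by blast
  qed
  then have eq: "card {xs \<in> ?F. ?top False xs \<and> pos xs} = card {xs \<in> ?F. ?top True xs \<and> neg xs}"
    using card_image[OF inj, of "{xs \<in> ?F. ?top False xs \<and> pos xs}"] by simp
  have "alternating_flags \<sigma> (Suc n) = {xs \<in> ?F. ?top True xs \<and> pos xs} \<union> {xs \<in> ?F. ?top False xs \<and> pos xs}"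
    using top by (auto simp: alternating_flags_def pos_def less_Suc_eq_le)
  then have "card (alternating_flags \<sigma> (Suc n)) =
      card {xs \<in> ?F. ?top True xs \<and> pos xs} + card {xs \<in> ?F. ?top False xs \<and> pos xs}"
    using top fin by (simp only: ) (rule card_Un_disjoint, auto)
  also have "\<dots> = card {xs \<in> ?F. ?top True xs \<and> pos xs} + card {xs \<in> ?F. ?top True xs \<and> neg xs}"
    by (simp only: eq)
  also have "\<dots> = card ({xs \<in> ?F. ?top True xs \<and> pos xs} \<union> {xs \<in> ?F. ?top True xs \<and> neg xs})"
    using fin by (intro card_Un_disjoint[symmetric]) (auto simp: pos_def neg_def)
  also have "{xs \<in> ?F. ?top True xs \<and> pos xs} \<union> {xs \<in> ?F. ?top True xs \<and> neg xs} = ?R"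
    by (auto simp: pos_def neg_def)
  finally show ?thesis .
qed

text \<open>\<open>P\<close> is counted in two ways. By \<open>odd_card_near_alternating\<close> a
  flag has an odd number of admissible positions exactly when its signs alternate throughout,
  starting with either sign. On the other hand, a chain with member \<open>i\<close> deleted has two
  completions in \<open>H\<close>, which \<open>g\<close> pairs off, except when the missing last
  entry is \<open>Suc n\<close>.\<close>

lemma even_card_alternating_flags_Suc:
  assumes "antipodal \<sigma> (Suc n)"
  shows "even (card (alternating_flags \<sigma> (Suc n))) \<longleftrightarrow> even (card (alternating_flags \<sigma> n))"
proof -
  define H where "H = {xs \<in> signed_flags (Suc n). (Suc n, True) \<in> set xs}"
  define P where "P = (SIGMA xs:H. {i. near_alternating \<sigma> n xs i})"
  \<comment> \<open>Changing the sign of the last entry gives the other flag with the same first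
    \<open>n\<close> members. If that entry is \<open>Suc n\<close>, its sign must stay positive for
    the flag to lie in \<open>H\<close>, so \<open>flip\<close> leaves it alone.\<close>
  define flip where "flip ys = (if fst (last ys) = Suc n then ys
      else butlast ys @ [(fst (last ys), \<not> snd (last ys))])" for ys :: "(nat \<times> bool) list"
  define g where "g = (\<lambda>(xs, i). (if i < n then swap_at i xs else flip xs, i))"
  have finH: "finite H" using finite_signed_flags by (simp add: H_def)
  have finI: "finite {i. near_alternating \<sigma> n xs i}" for xs
    by (rule finite_subset[of _ "{..n}"]) (auto simp: near_alternating_def)
  have finP: "finite P" using finH finI by (auto simp: P_def)
  have len: "length xs = Suc n" if "xs \<in> H" for xs
    using that length_signed_flag by (auto simp: H_def)
  have flip: "flip xs \<in> H" "flip (flip xs) = xs" "\<And>j. j < n \<Longrightarrow> take (Suc j) (flip xs) = take (Suc j) xs"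
    "flip xs = xs \<longleftrightarrow> fst (last xs) = Suc n" if xsH: "xs \<in> H" for xs
  proof -
    obtain ys a b where xs: "xs = ys @ [(a, b)]"
      using len[OF xsH] by (metis append_butlast_last_id length_0_conv nat.distinct(1) prod.collapse)
    have "ys @ [(a, \<not> b)] \<in> signed_flags (Suc n)" using xsH xs flip_last_flag by (auto simp: H_def)
    moreover have "length ys = n" using len[OF xsH] xs by simp
    ultimately show "flip xs \<in> H" "flip (flip xs) = xs" "\<And>j. j < n \<Longrightarrow> take (Suc j) (flip xs) = take (Suc j) xs"
      "flip xs = xs \<longleftrightarrow> fst (last xs) = Suc n"
      using xsH xs by (auto simp: flip_def H_def)
  qed
  have swap: "swap_at i xs \<in> H" "swap_at i (swap_at i xs) = xs" "swap_at i xs \<noteq> xs"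
    "near_alternating \<sigma> n (swap_at i xs) i \<longleftrightarrow> near_alternating \<sigma> n xs i" if "xs \<in> H" "i < n" for xs i
  proof -
    have fl: "xs \<in> signed_flags (Suc n)" "Suc i < Suc n" using that by (auto simp: H_def)
    show "swap_at i (swap_at i xs) = xs" "swap_at i xs \<noteq> xs" using swap_at_flag[OF fl] by auto
    show "swap_at i xs \<in> H" using swap_at_flag[OF fl] that unfolding H_def by auto
    show "near_alternating \<sigma> n (swap_at i xs) i \<longleftrightarrow> near_alternating \<sigma> n xs i"
      using len[OF that(1)] fl by (intro near_alternating_cong set_take_swap_at) auto
  qed
  have flip_alt: "near_alternating \<sigma> n (flip xs) n \<longleftrightarrow> near_alternating \<sigma> n xs n" if "xs \<in> H" for xs
    using flip(3)[OF that] by (intro near_alternating_cong) auto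
  have le: "i \<le> n" if "near_alternating \<sigma> n xs i" for xs i
    using that by (simp add: near_alternating_def)
  have "even (card P) \<longleftrightarrow> even (card {z \<in> P. g z = z})"
  proof (rule even_card_iff_even_card_fixpoints[OF finP])
    fix z assume "z \<in> P"
    then obtain xs i where z: "z = (xs, i)" "xs \<in> H" "near_alternating \<sigma> n xs i"
      by (auto simp: P_def)
    show "g z \<in> P" "g (g z) = z"
      using z swap flip flip_alt le[OF z(3)] by (auto simp: g_def P_def le_less)
  qed
  \<comment> \<open>A swap never fixes a flag, so a fixed point has \<open>i = n\<close> and ends in
    \<open>(Suc n, True)\<close>. The entries before it form an alternating flag on
    \<open>{1..n}\<close>.\<close>
  also have "{z \<in> P. g z = z} = (\<lambda>ys. (ys @ [(Suc n, True)], n)) ` alternating_flags \<sigma> n"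
  proof (intro equalityI subsetI)
    fix z assume "z \<in> {z \<in> P. g z = z}"
    then obtain xs i where z: "z = (xs, i)" "xs \<in> H" "near_alternating \<sigma> n xs i" "g (xs, i) = (xs, i)"
      by (auto simp: P_def)
    have i: "i = n" using z swap(3)[of xs i] le[OF z(3)] by (auto simp: g_def le_less)
    then have "fst (last xs) = Suc n" using z flip(4) by (auto simp: g_def)
    then obtain ys b where xs: "xs = ys @ [(Suc n, b)]"
      using len[OF z(2)] by (metis append_butlast_last_id length_0_conv nat.distinct(1) prod.collapse)
    have "b" using z(2) xs unfolding H_def signed_flags_def by (force simp: image_iff)
    moreover have "ys \<in> alternating_flags \<sigma> n"
    proof -
      have "ys \<in> signed_flags n" using z(2) xs signed_flags_snoc by (auto simp: H_def)
      then show ?thesis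
        using z(3) i xs length_signed_flag[of ys n] by (auto simp: alternating_flags_def near_alternating_def)
    qed
    ultimately show "z \<in> (\<lambda>ys. (ys @ [(Suc n, True)], n)) ` alternating_flags \<sigma> n"
      using z xs i by auto
  next
    fix z assume "z \<in> (\<lambda>ys. (ys @ [(Suc n, True)], n)) ` alternating_flags \<sigma> n"
    then obtain ys where z: "z = (ys @ [(Suc n, True)], n)" and ys: "ys \<in> alternating_flags \<sigma> n" by blast
    have fl: "ys \<in> signed_flags n" using ys by (simp add: alternating_flags_def)
    then have "ys @ [(Suc n, True)] \<in> H" by (simp add: H_def signed_flags_snoc)
    moreover have "near_alternating \<sigma> n (ys @ [(Suc n, True)]) n"
      using ys length_signed_flag[OF fl] by (auto simp: alternating_flags_def near_alternating_def)
    ultimately show "z \<in> {z \<in> P. g z = z}" by (auto simp: z P_def g_def flip_def)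
  qed
  also have "card \<dots> = card (alternating_flags \<sigma> n)"
    by (intro card_image) (auto simp: inj_on_def)
  finally have "even (card P) \<longleftrightarrow> even (card (alternating_flags \<sigma> n))" .
  moreover have "even (card P) \<longleftrightarrow> even (card (alternating_flags \<sigma> (Suc n)))"
  proof -
    have "card P = (\<Sum>xs\<in>H. card {i. near_alternating \<sigma> n xs i})"
      using finH finI by (simp add: P_def)
    moreover have "{xs \<in> H. odd (card {i. near_alternating \<sigma> n xs i})} =
        {xs \<in> signed_flags (Suc n). (Suc n, True) \<in> set xs \<and>
      ((\<forall>j\<le>n. \<sigma> (set (take (Suc j) xs)) = even j) \<or> (\<forall>j\<le>n. \<sigma> (set (take (Suc j) xs)) = odd j))}"
      unfolding odd_card_near_alternating by (auto simp: H_def)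
    ultimately show ?thesis
      by (simp only: even_sum_iff[OF finH] card_alternating_flags_Suc[OF assms])
  qed
  ultimately show ?thesis by simp
qed

text \<open>A version of Ky Fan's lemma. Labels with weakly increasing absolute values and no complementary
  pair alternate along a flag iff their signs do, so only signs need to be recorded.\<close>
theorem odd_card_alternating_flags:
  assumes "antipodal \<sigma> n"
  shows "odd (card (alternating_flags \<sigma> n))"
  using assms
proof (induction n)
  case 0
  have "alternating_flags \<sigma> 0 = {[]}" by (auto simp: alternating_flags_def signed_flags_def)
  then show ?case by simp
next
  case (Suc n)
  then have "antipodal \<sigma> n"
    unfolding antipodal_def using atLeastatMost_subset_iff[of 1 n 1 "Suc n"] by (meson le_SucI order_refl order_trans)
  then show ?case using Suc even_card_alternating_flags_Suc by blast
qed

section \<open>Schrijver graphs\<close>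

lemma graph_hom_comp:
  assumes "graph_hom V E W F f" "graph_hom W F X H g"
  shows "graph_hom V E X H (g \<circ> f)"
  using assms by (simp add: graph_hom_def)

lemma graph_hom_subset:
  assumes "graph_hom V E W F f" "U \<subseteq> V"
  shows "graph_hom U E W F f"
  using assms unfolding graph_hom_def by blast

text \<open>By stability every other element is at most \<open>Max A - 2\<close>, hence at most
  \<open>n\<close>. If both 1 and \<open>n\<close> survived, then \<open>Max A\<close> would be
  \<open>n + 2\<close>, and its presence together with 1 would contradict the stability of
  \<open>A\<close>.\<close>

lemma remove_Max_schrijver:
  "graph_hom (schrijver_vertices (Suc (Suc n)) (Suc k)) kneser_adj (schrijver_vertices n k) kneser_adj
     (\<lambda>A. A - {Max A})"
  unfolding graph_hom_def
proof (intro conjI ballI impI)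
  fix A assume "A \<in> schrijver_vertices (Suc (Suc n)) (Suc k)"
  then have A: "A \<subseteq> {1..Suc (Suc n)}" "card A = Suc k" "stable_set (Suc (Suc n)) A"
    by (auto simp: schrijver_vertices_def kneser_vertices_def)
  have fin: "finite A" and ne: "A \<noteq> {}" using A by (auto intro: finite_subset)
  have Max: "Max A \<in> A" "\<And>a. a \<in> A \<Longrightarrow> a \<le> Max A" using fin ne by auto
  have gap: "a + 2 \<le> Max A" if "a \<in> A" "a \<noteq> Max A" for a
  proof (rule ccontr)
    assume "\<not> a + 2 \<le> Max A"
    then have "Max A = Suc a" using Max(2)[OF that(1)] that(2) by simp
    moreover have "a \<in> {1..<Suc (Suc n)}" using A Max that calculation by auto
    ultimately show False using A(3) Max(1) that(1) by (auto simp: stable_set_def)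
  qed
  have bound: "Max A \<le> Suc (Suc n)" using A Max by auto
  have "stable_set n (A - {Max A})"
    unfolding stable_set_def
  proof (intro conjI ballI)
    fix i assume "i \<in> {1..<n}"
    then show "\<not> (i \<in> A - {Max A} \<and> Suc i \<in> A - {Max A})"
      using A(3) by (auto simp: stable_set_def)
  next
    show "\<not> (1 \<in> A - {Max A} \<and> n \<in> A - {Max A})"
    proof
      assume *: "1 \<in> A - {Max A} \<and> n \<in> A - {Max A}"
      then have "Max A = Suc (Suc n)" using gap[of n] bound by auto
      then show False using A(3) * Max(1) by (auto simp: stable_set_def)
    qed
  qed
  moreover have "A - {Max A} \<subseteq> {1..n}" using gap bound A(1) by fastforce
  ultimately show "A - {Max A} \<in> schrijver_vertices n k"
    using A fin Max(1) by (simp add: schrijver_vertices_def kneser_vertices_def)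
qed (auto simp: kneser_adj_def)

text \<open>The nine stable 2-subsets are the diagonals of a hexagon, adjacent when they share no
  endpoint. The table is one explicit homomorphism, and its final default is the value at
  \<open>{4,6}\<close>.\<close>

definition hexagon_map :: "nat set \<Rightarrow> nat \<times> nat" where
  "hexagon_map A =
    (if A = {1,3} then (1,2) else if A = {1,4} then (1,3) else if A = {1,5} then (4,2)
     else if A = {2,4} then (2,3) else if A = {2,5} then (4,1) else if A = {2,6} then (2,1)
     else if A = {3,5} then (3,2) else if A = {3,6} then (3,4) else (2,4))"

lemma schrijver_vertices_6_2:
  "schrijver_vertices 6 2 \<subseteq> {{1,3},{1,4},{1,5},{2,4},{2,5},{2,6},{3,5},{3,6},{4,6}}"
proof
  fix A assume "A \<in> schrijver_vertices 6 2"
  then have A: "A \<subseteq> {1..6}" "card A = 2" "stable_set 6 A"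
    by (auto simp: schrijver_vertices_def kneser_vertices_def)
  then obtain a b where ab: "A = {a, b}" "a < b"
    by (metis card_2_iff insert_commute linorder_neqE_nat)
  have "1 \<le> a" "b \<le> 6" using A(1) ab by auto
  moreover have "b \<noteq> Suc a" "\<not> (a = 1 \<and> b = 6)" using A ab by (auto simp: stable_set_def)
  ultimately have "a = 1 \<and> b = 3 \<or> a = 1 \<and> b = 4 \<or> a = 1 \<and> b = 5 \<or> a = 2 \<and> b = 4 \<or> a = 2 \<and> b = 5
      \<or> a = 2 \<and> b = 6 \<or> a = 3 \<and> b = 5 \<or> a = 3 \<and> b = 6 \<or> a = 4 \<and> b = 6"
    using \<open>a < b\<close> by presburger
  then show "A \<in> {{1,3},{1,4},{1,5},{2,4},{2,5},{2,6},{3,5},{3,6},{4,6}}"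
    unfolding \<open>A = {a, b}\<close> by (elim disjE conjE) simp_all
qed

lemma hexagon_map_hom:
  "graph_hom (schrijver_vertices 6 2) kneser_adj (shift_vertices 4) shift_adj hexagon_map"
proof -
  let ?V = "{{1,3},{1,4},{1,5},{2,4},{2,5},{2,6},{3,5},{3,6},{4,6}} :: nat set set"
  have h: "hexagon_map {1,3} = (1,2)" "hexagon_map {1,4} = (1,3)" "hexagon_map {1,5} = (4,2)"
    "hexagon_map {2,4} = (2,3)" "hexagon_map {2,5} = (4,1)" "hexagon_map {2,6} = (2,1)"
    "hexagon_map {3,5} = (3,2)" "hexagon_map {3,6} = (3,4)" "hexagon_map {4,6} = (2,4)"
    by (simp_all add: hexagon_map_def doubleton_eq_iff)
  have adj: "kneser_adj {a, b} {c, d} \<longleftrightarrow> a \<noteq> c \<and> a \<noteq> d \<and> b \<noteq> c \<and> b \<noteq> d" for a b c d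
    by (auto simp: kneser_adj_def)
  have "graph_hom ?V kneser_adj (shift_vertices 4) shift_adj hexagon_map"
    by (simp only: graph_hom_def ball_simps h adj) (simp add: shift_adj_def shift_vertices_def)
  then show ?thesis by (rule graph_hom_subset) (rule schrijver_vertices_6_2)
qed

theorem ex_hom_schrijver_shift:
  assumes "k \<ge> 2"
  shows "\<exists>f. graph_hom (schrijver_vertices (2*k+2) k) kneser_adj (shift_vertices 4) shift_adj f"
  using assms
proof (induction k rule: dec_induct)
  case base
  show ?case using hexagon_map_hom by auto
next
  case (step k)
  then show ?case using graph_hom_comp[OF remove_Max_schrijver[of "2 * k + 2" k]] by auto
qed

section \<open>Rainbow orders in the shift graph\<close>

lemma shift_vertices_4:
  "shift_vertices 4 = {(1,2),(1,3),(1,4),(2,1),(2,3),(2,4),(3,1),(3,2),(3,4),(4,1),(4,2),(4,3)}"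
proof -
  have *: "{1..4::nat} = {1,2,3,4}" by auto
  show ?thesis unfolding shift_vertices_def * by auto
qed

text \<open>Suppose \<open>F a, F c\<close> have first coordinates 1, 3 and \<open>G b, G d\<close> have 2, 4. The summands
  correspond to the nine orders \<open>(w, x, y, z)\<close> of \<open>a, b, c, d\<close> for which \<open>F w, G x, F y, G z\<close> can still
  have first coordinates 1, 2, 3, 4.\<close>
definition num_rainbow_orders ::
    "(nat \<times> nat) \<Rightarrow> (nat \<times> nat) \<Rightarrow> (nat \<times> nat) \<Rightarrow> (nat \<times> nat) \<Rightarrow> nat" where
  "num_rainbow_orders fb fd ga gc =
     1 + of_bool (fst fb = 3 \<and> fst gc = 2) + of_bool (fst fd = 3 \<and> fst gc = 4)
       + of_bool (fst fb = 1 \<and> fst ga = 2) + of_bool (fst fd = 1 \<and> fst ga = 4)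
       + of_bool (fst fb = 1 \<and> fst fd = 3 \<and> fst ga = 2 \<and> fst gc = 4)
       + of_bool (fst fb = 1 \<and> fst fd = 3 \<and> fst gc = 2 \<and> fst ga = 4)
       + of_bool (fst fd = 1 \<and> fst fb = 3 \<and> fst ga = 2 \<and> fst gc = 4)
       + of_bool (fst fd = 1 \<and> fst fb = 3 \<and> fst gc = 2 \<and> fst ga = 4)"

text \<open>This is the case where \<open>F a, G b, F c, G d\<close> are (1,2), (2,3), (3,4), (4,1).
  Adjacency to a vertex of this cycle leaves five candidates for each of the other four images, so
  the parity is a check over 5^4 combinations.\<close>

lemma even_num_rainbow_orders_1:
  assumes V: "fb \<in> shift_vertices 4" "fd \<in> shift_vertices 4" "ga \<in> shift_vertices 4" "gc \<in> shift_vertices 4"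
    and outer: "shift_adj fb (4,1)" "shift_adj fd (2,3)" "shift_adj (3,4) ga" "shift_adj (1,2) gc"
    and inner: "shift_adj fb ga" "shift_adj fb gc" "shift_adj fd ga" "shift_adj fd gc"
  shows "even (num_rainbow_orders fb fd ga gc)"
proof -
  have b: "fb \<in> {(1,2),(1,3),(1,4),(2,4),(3,4)}"
    using V(1) outer(1) unfolding shift_vertices_4 by (elim insertE emptyE) (simp_all add: shift_adj_def)
  have d: "fd \<in> {(3,1),(3,2),(3,4),(1,2),(4,2)}"
    using V(2) outer(2) unfolding shift_vertices_4 by (elim insertE emptyE) (simp_all add: shift_adj_def)
  have a: "ga \<in> {(4,1),(4,2),(4,3),(1,3),(2,3)}"
    using V(3) outer(3) unfolding shift_vertices_4 by (elim insertE emptyE) (simp_all add: shift_adj_def)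
  have c: "gc \<in> {(2,1),(2,3),(2,4),(3,1),(4,1)}"
    using V(4) outer(4) unfolding shift_vertices_4 by (elim insertE emptyE) (simp_all add: shift_adj_def)
  show ?thesis
    using b d a c inner
    by (elim insertE emptyE; hypsubst; simp add: shift_adj_def num_rainbow_orders_def)
qed

text \<open>The second 4-cycle arises from the first by exchanging the numbers 1 and 3 and the roles
  of \<open>ga\<close> and \<open>gc\<close>, which leaves \<open>num_rainbow_orders\<close>
  invariant.\<close>

lemma even_num_rainbow_orders_2:
  assumes V: "fb \<in> shift_vertices 4" "fd \<in> shift_vertices 4" "ga \<in> shift_vertices 4" "gc \<in> shift_vertices 4"
    and outer: "shift_adj fb (4,3)" "shift_adj fd (2,1)" "shift_adj (3,2) ga" "shift_adj (1,4) gc"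
    and inner: "shift_adj fb ga" "shift_adj fb gc" "shift_adj fd ga" "shift_adj fd gc"
  shows "even (num_rainbow_orders fb fd ga gc)"
proof -
  have b: "fb \<in> {(3,2),(3,1),(3,4),(2,4),(1,4)}"
    using V(1) outer(1) unfolding shift_vertices_4 by (elim insertE emptyE) (simp_all add: shift_adj_def)
  have d: "fd \<in> {(1,3),(1,2),(1,4),(3,2),(4,2)}"
    using V(2) outer(2) unfolding shift_vertices_4 by (elim insertE emptyE) (simp_all add: shift_adj_def)
  have a: "ga \<in> {(2,1),(2,3),(2,4),(1,3),(4,3)}"
    using V(3) outer(3) unfolding shift_vertices_4 by (elim insertE emptyE) (simp_all add: shift_adj_def)
  have c: "gc \<in> {(4,1),(4,2),(4,3),(3,1),(2,1)}"
    using V(4) outer(4) unfolding shift_vertices_4 by (elim insertE emptyE) (simp_all add: shift_adj_def)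
  show ?thesis
    using b d a c inner
    by (elim insertE emptyE; hypsubst; simp add: shift_adj_def num_rainbow_orders_def)
qed

text \<open>Each edge needs an endpoint whose second coordinate is the first coordinate of the other
  endpoint. A vertex can serve only one of its two edges, so the four vertices serve the four edges
  in one of the two directions around the cycle.\<close>

lemma rainbow_four_cycle:
  assumes "fst fa = 1" "fst gb = 2" "fst fc = 3" "fst gd = 4"
    "shift_adj fa gb" "shift_adj fa gd" "shift_adj fc gb" "shift_adj fc gd"
  shows "fa = (1,2) \<and> gb = (2,3) \<and> fc = (3,4) \<and> gd = (4,1) \<or>
         fa = (1,4) \<and> gb = (2,1) \<and> fc = (3,2) \<and> gd = (4,3)"
  using assms by (cases fa; cases gb; cases fc; cases gd) (auto simp: shift_adj_def)

lemma length_filter_Cons: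
  "length (filter P (x # xs)) = of_bool (P x) + length (filter P xs)"
  by simp

lemma even_card_rainbow_orders:
  fixes F G :: "'a \<Rightarrow> nat \<times> nat"
  assumes S: "card S = 4"
    and V: "\<And>s. s \<in> S \<Longrightarrow> F s \<in> shift_vertices 4" "\<And>s. s \<in> S \<Longrightarrow> G s \<in> shift_vertices 4"
    and adj: "\<And>s t. s \<in> S \<Longrightarrow> t \<in> S \<Longrightarrow> s \<noteq> t \<Longrightarrow> shift_adj (F s) (G t)"
  shows "even (card {(w, x, y, z). distinct [w, x, y, z] \<and> {w, x, y, z} \<subseteq> S \<and>
    fst (F w) = 1 \<and> fst (G x) = 2 \<and> fst (F y) = 3 \<and> fst (G z) = 4})" (is "even (card ?W)")
proof (cases "?W = {}")
  case False
  then obtain a b c d where abcd: "distinct [a, b, c, d]" "{a, b, c, d} \<subseteq> S"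
    "fst (F a) = 1" "fst (G b) = 2" "fst (F c) = 3" "fst (G d) = 4" by auto
  have fin: "finite S" using S card.infinite by fastforce
  have Seq: "S = {a, b, c, d}"
    using abcd(1) S card_subset_eq[OF fin abcd(2)] by simp
  have cyc: "F a = (1,2) \<and> G b = (2,3) \<and> F c = (3,4) \<and> G d = (4,1) \<or>
         F a = (1,4) \<and> G b = (2,1) \<and> F c = (3,2) \<and> G d = (4,3)"
    using abcd adj by (intro rainbow_four_cycle) auto
  have inner: "shift_adj (F b) (G a)" "shift_adj (F b) (G c)" "shift_adj (F d) (G a)" "shift_adj (F d) (G c)"
    and outer: "shift_adj (F b) (G d)" "shift_adj (F d) (G b)" "shift_adj (F c) (G a)" "shift_adj (F a) (G c)"
    using abcd(1,2) adj by auto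
  have even: "even (num_rainbow_orders (F b) (F d) (G a) (G c))"
    using cyc
  proof (elim disjE conjE)
    assume "F a = (1,2)" "G b = (2,3)" "F c = (3,4)" "G d = (4,1)"
    then show ?thesis
      using outer by (intro even_num_rainbow_orders_1 inner) (use V abcd(2) in auto)
  next
    assume "F a = (1,4)" "G b = (2,1)" "F c = (3,2)" "G d = (4,3)"
    then show ?thesis
      using outer by (intro even_num_rainbow_orders_2 inner) (use V abcd(2) in auto)
  qed
  let ?P = "\<lambda>(w, x, y, z). fst (F w) = 1 \<and> fst (G x) = 2 \<and> fst (F y) = 3 \<and> fst (G z) = 4"
  \<comment> \<open>These are the permutations that keep \<open>c\<close>, \<open>d\<close>,
    \<open>a\<close>, \<open>b\<close> out of the places of \<open>w\<close>, \<open>x\<close>,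
    \<open>y\<close>, \<open>z\<close> respectively, since \<open>F c\<close>, \<open>G d\<close>,
    \<open>F a\<close>, \<open>G b\<close> have first coordinates 3, 4, 1, 2. As for derangements of
    four objects, nine remain.\<close>
  let ?L = "[(a,b,c,d),(a,c,b,d),(a,b,d,c),(b,a,c,d),(d,b,c,a),(b,a,d,c),(b,c,d,a),(d,a,b,c),(d,c,b,a)]"
  have "?W = set (filter ?P ?L)"
  proof (intro equalityI subsetI)
    fix q assume "q \<in> ?W"
    moreover obtain w x y z where q: "q = (w, x, y, z)" by (cases q)
    ultimately have *: "distinct [w, x, y, z]" "{w, x, y, z} \<subseteq> {a, b, c, d}" "?P (w, x, y, z)"
      by (auto simp: Seq)
    have "w \<in> {a, b, d}" "x \<in> {a, b, c}" "y \<in> {b, c, d}" "z \<in> {a, c, d}"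
      using *(2,3) abcd(3-6) by auto
    then have "(w, x, y, z) \<in> set ?L"
      using *(1) by (elim insertE emptyE; hypsubst; simp)
    then show "q \<in> set (filter ?P ?L)"
      unfolding set_filter q using *(3) by blast
  next
    fix q assume "q \<in> set (filter ?P ?L)"
    moreover obtain w x y z where q: "q = (w, x, y, z)" by (cases q)
    ultimately have *: "(w, x, y, z) \<in> set ?L" "?P (w, x, y, z)"
      unfolding set_filter by blast+
    have "distinct [w, x, y, z] \<and> {w, x, y, z} \<subseteq> S"
      using *(1) abcd(1,2) unfolding list.set by (elim insertE emptyE) auto
    then show "q \<in> ?W" using *(2) q by simp
  qed
  moreover have "distinct ?L" using abcd(1) by auto
  ultimately have "card ?W = length (filter ?P ?L)"
    by (simp only: distinct_card[OF distinct_filter])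
  also have "\<dots> = num_rainbow_orders (F b) (F d) (G a) (G c)"
    unfolding length_filter_Cons num_rainbow_orders_def using abcd(3-6) by (simp add: conj_ac)
  finally show ?thesis using even by simp
qed (simp only: card.empty, simp)

section \<open>Kneser graphs\<close>

lemma shift_adj_fst_neq:
  assumes "p \<in> shift_vertices m" "q \<in> shift_vertices m" "shift_adj p q"
  shows "fst p \<noteq> fst q"
  using assms by (auto simp: shift_vertices_def shift_adj_def)

section \<open>Sides of a signed set, the sign of its least element, and largest colours\<close>

definition side :: "bool \<Rightarrow> (nat \<times> bool) set \<Rightarrow> nat set" where
  "side b x = {a. (a, b) \<in> x}"

lemma side_insert: "side b (insert (a, b') x) = (if b = b' then insert a (side b x) else side b x)"
  by (auto simp: side_def)

lemma side_empty: "side b {} = {}"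
  by (simp add: side_def)

lemma side_negate: "side b (apsnd Not ` x) = side (\<not> b) x"
  by (force simp: side_def apsnd_def)

lemma side_subset_fst: "side b x \<subseteq> fst ` x"
  by (force simp: side_def)

lemma finite_side: "finite x \<Longrightarrow> finite (side b x)"
  using finite_subset[OF side_subset_fst] by blast

lemma side_disjoint:
  assumes "inj_on fst x"
  shows "side b x \<inter> side (\<not> b) x = {}"
  using inj_onD[OF assms, of "(_, b)" "(_, \<not> b)"] by (auto simp: side_def)

lemma card_sides:
  assumes "finite x"
  shows "card x = card (side b x) + card (side (\<not> b) x)"
proof -
  have "x = (\<lambda>a. (a, b)) ` side b x \<union> (\<lambda>a. (a, \<not> b)) ` side (\<not> b) x"
  proof (rule set_eqI)
    fix z :: "nat \<times> bool"
    obtain a c where "z = (a, c)" by (cases z)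
    then show "z \<in> x \<longleftrightarrow> z \<in> (\<lambda>a. (a, b)) ` side b x \<union> (\<lambda>a. (a, \<not> b)) ` side (\<not> b) x"
      by (cases "c = b") (auto simp: side_def)
  qed
  then have "card x = card ((\<lambda>a. (a, b)) ` side b x \<union> (\<lambda>a. (a, \<not> b)) ` side (\<not> b) x)"
    by (rule arg_cong)
  also have "\<dots> = card ((\<lambda>a. (a, b)) ` side b x) + card ((\<lambda>a. (a, \<not> b)) ` side (\<not> b) x)"
    using assms by (intro card_Un_disjoint) (auto intro: finite_side)
  finally show ?thesis by (simp add: card_image inj_on_def)
qed

definition min_sign :: "(nat \<times> bool) set \<Rightarrow> bool" where
  "min_sign x \<longleftrightarrow> (Min (fst ` x), True) \<in> x"

text \<open>If the least element stays the same, so does the sign. A change of sign thus means that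
  the added element is the new least one. This will force the signs of the first entries of an
  alternating flag.\<close>

lemma min_sign_insert:
  assumes "finite x" "a \<notin> fst ` x" "min_sign (insert (a, b) x) \<noteq> min_sign x"
  shows "min_sign (insert (a, b) x) = b"
proof (cases "x = {}")
  case False
  have ne: "fst ` x \<noteq> {}" "finite (fst ` x)" using False assms by auto
  have M: "Min (fst ` x) \<in> fst ` x" using ne by simp
  have eq: "Min (fst ` insert (a, b) x) = min a (Min (fst ` x))" using ne by simp
  show ?thesis
  proof (cases "a < Min (fst ` x)")
    case True
    then show ?thesis using assms(2) eq by (force simp: min_sign_def)
  next
    case False
    then have "Min (fst ` insert (a, b) x) = Min (fst ` x)" using eq by simp
    moreover have "Min (fst ` x) \<noteq> a" using M assms(2) by metis
    ultimately show ?thesis using assms(3) by (simp add: min_sign_def)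
  qed
qed (simp add: min_sign_def)

lemma min_sign_negate:
  assumes "finite x" "x \<noteq> {}" "inj_on fst x"
  shows "min_sign (apsnd Not ` x) = (\<not> min_sign x)"
proof -
  have "Min (fst ` x) \<in> fst ` x" using assms by simp
  then obtain b where b: "(Min (fst ` x), b) \<in> x" by force
  have uniq: "c = b" if "(Min (fst ` x), c) \<in> x" for c
    using inj_onD[OF assms(3) _ that b] by simp
  have "fst ` apsnd Not ` x = fst ` x" by (force simp: image_image)
  moreover have "(a, True) \<in> apsnd Not ` x \<longleftrightarrow> (a, False) \<in> x" for a
    by (force simp: apsnd_def)
  ultimately have "min_sign (apsnd Not ` x) \<longleftrightarrow> (Min (fst ` x), False) \<in> x"
    by (simp add: min_sign_def)
  then show ?thesis using b uniq by (cases b) (auto simp: min_sign_def)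
qed

text \<open>The inserted 0 is the value when \<open>X\<close> has no \<open>k\<close>-subset. It
  lies below all actual colours, which start at 1.\<close>

definition top_colour :: "(nat set \<Rightarrow> nat) \<Rightarrow> nat \<Rightarrow> nat set \<Rightarrow> nat" where
  "top_colour c k X = Max (insert 0 (c ` {Y. Y \<subseteq> X \<and> card Y = k}))"

lemma top_colour_ge:
  assumes "finite X" "Y \<subseteq> X" "card Y = k"
  shows "c Y \<le> top_colour c k X"
  using assms unfolding top_colour_def by (intro Max_ge) auto

lemma top_colour_attained:
  assumes "finite X" "top_colour c k X \<noteq> 0"
  obtains Y where "Y \<subseteq> X" "card Y = k" "c Y = top_colour c k X"
proof -
  have "top_colour c k X \<in> insert 0 (c ` {Y. Y \<subseteq> X \<and> card Y = k})"
    unfolding top_colour_def using assms by (intro Max_in) auto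
  then show ?thesis using assms(2) that by auto
qed

lemma top_colour_small:
  assumes "finite X" "card X < k"
  shows "top_colour c k X = 0"
proof (rule ccontr)
  assume "top_colour c k X \<noteq> 0"
  then obtain Y where "Y \<subseteq> X" "card Y = k" using assms(1) by (auto elim: top_colour_attained)
  then show False using assms card_mono[of X Y] by simp
qed

lemma top_colour_mono:
  assumes "finite X'" "X \<subseteq> X'"
  shows "top_colour c k X \<le> top_colour c k X'"
  unfolding top_colour_def using assms by (intro Max_mono) auto

lemma top_colour_exact:
  assumes "finite X" "card X = k"
  shows "top_colour c k X = c X"
proof -
  have "Y = X" if "Y \<subseteq> X" "card Y = k" for Y
    using card_subset_eq[OF assms(1) that(1)] assms(2) that(2) by simp
  then have "{Y. Y \<subseteq> X \<and> card Y = k} = {X}" using assms(2) by auto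
  then show ?thesis by (simp add: top_colour_def)
qed

section \<open>The sign function of a homomorphism from KG(2k+2,k), with k = m + 1\<close>

locale kneser_shift_hom =
  fixes m :: nat and f :: "nat set \<Rightarrow> nat \<times> nat"
  assumes hom: "graph_hom (kneser_vertices (2*m+4) (Suc m)) kneser_adj (shift_vertices 4) shift_adj f"
begin

abbreviation colour :: "nat set \<Rightarrow> nat" where
  "colour Y \<equiv> fst (f Y)"

abbreviation maxcol :: "nat set \<Rightarrow> nat" where
  "maxcol \<equiv> top_colour colour (Suc m)"

lemma colour_range:
  assumes "Y \<subseteq> {1..2*m+4}" "card Y = Suc m"
  shows "f Y \<in> shift_vertices 4" "1 \<le> colour Y" "colour Y \<le> 4"
proof -
  show "f Y \<in> shift_vertices 4" using assms hom by (auto simp: graph_hom_def kneser_vertices_def)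
  then show "1 \<le> colour Y" "colour Y \<le> 4" by (auto simp: shift_vertices_def)
qed

lemma f_adj:
  assumes "Y \<subseteq> {1..2*m+4}" "card Y = Suc m" "Z \<subseteq> {1..2*m+4}" "card Z = Suc m" "Y \<inter> Z = {}"
  shows "shift_adj (f Y) (f Z)"
  using assms hom by (auto simp: graph_hom_def kneser_vertices_def kneser_adj_def)

lemma colour_neq:
  assumes "Y \<subseteq> {1..2*m+4}" "card Y = Suc m" "Z \<subseteq> {1..2*m+4}" "card Z = Suc m" "Y \<inter> Z = {}"
  shows "colour Y \<noteq> colour Z"
  using assms f_adj colour_range(1) shift_adj_fst_neq by metis

lemma maxcol_pos:
  assumes "X \<subseteq> {1..2*m+4}" "Suc m \<le> card X"
  shows "0 < maxcol X"
proof -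
  obtain Y where Y: "Y \<subseteq> X" "card Y = Suc m" using assms(2) obtain_subset_with_card_n by metis
  then have "1 \<le> colour Y" using assms(1) colour_range by auto
  also have "colour Y \<le> maxcol X" using Y assms finite_subset by (intro top_colour_ge) auto
  finally show ?thesis by simp
qed

lemma maxcol_le_4:
  assumes "X \<subseteq> {1..2*m+4}"
  shows "maxcol X \<le> 4"
proof (cases "maxcol X = 0")
  case False
  then obtain Y where "Y \<subseteq> X" "card Y = Suc m" "colour Y = maxcol X"
    using finite_subset[OF assms] by (auto elim: top_colour_attained)
  then show ?thesis using colour_range(3)[of Y] assms by auto
qed simp

text \<open>A common positive value would be attained by a subset of size \<open>Suc m\<close> in
  each of the two sets. These subsets are disjoint, hence adjacent, and cannot share a
  colour.\<close>

lemma maxcol_neq: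
  assumes "X \<subseteq> {1..2*m+4}" "X' \<subseteq> {1..2*m+4}" "X \<inter> X' = {}" "Suc m \<le> card X"
  shows "maxcol X \<noteq> maxcol X'"
proof
  assume eq: "maxcol X = maxcol X'"
  have "finite X" and "finite X'" using assms(1,2) finite_subset by auto
  moreover have "maxcol X \<noteq> 0" using maxcol_pos[OF assms(1,4)] by simp
  ultimately obtain Y where Y: "Y \<subseteq> X" "card Y = Suc m" "colour Y = maxcol X"
    by (auto elim: top_colour_attained)
  obtain Z where Z: "Z \<subseteq> X'" "card Z = Suc m" "colour Z = maxcol X'"
    using \<open>finite X'\<close> \<open>maxcol X \<noteq> 0\<close> eq by (auto elim: top_colour_attained)
  have "Y \<subseteq> {1..2*m+4}" "Z \<subseteq> {1..2*m+4}" "Y \<inter> Z = {}" using Y Z assms by auto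
  then show False using colour_neq[of Y Z] Y Z eq by simp
qed

definition flag_sign :: "(nat \<times> bool) set \<Rightarrow> bool" where
  "flag_sign x \<longleftrightarrow> (if card x \<le> 2*m then min_sign x else maxcol (side False x) < maxcol (side True x))"

text \<open>A signed set with more than \<open>2*m\<close> elements has at least
  \<open>Suc m\<close> of them on one side. Its two largest colours therefore differ, and negation
  exchanges the sides.\<close>

lemma antipodal_flag_sign: "antipodal flag_sign (2*m+4)"
  unfolding antipodal_def
proof (intro allI impI)
  fix x :: "(nat \<times> bool) set"
  assume x: "x \<noteq> {}" "finite x" "inj_on fst x" "fst ` x \<subseteq> {1..2*m+4}"
  have "inj (apsnd Not :: nat \<times> bool \<Rightarrow> _)" by (auto simp: inj_on_def)
  then have card: "card (apsnd Not ` x) = card x" by (meson card_image inj_on_subset subset_UNIV)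
  show "flag_sign (apsnd Not ` x) = (\<not> flag_sign x)"
  proof (cases "card x \<le> 2*m")
    case True
    then show ?thesis using x card min_sign_negate by (simp add: flag_sign_def)
  next
    case False
    have sub: "side b x \<subseteq> {1..2*m+4}" for b using side_subset_fst x(4) by blast
    have disj: "side True x \<inter> side False x = {}" using side_disjoint[OF x(3), of True] by simp
    have "Suc m \<le> card (side True x) \<or> Suc m \<le> card (side False x)"
      using card_sides[OF x(2), of True] False by auto
    then have "maxcol (side True x) \<noteq> maxcol (side False x)"
      using maxcol_neq[OF sub sub] disj by (metis inf_commute)
    then show ?thesis using False card by (auto simp: flag_sign_def side_negate)
  qed
qed

text \<open>Both sides of \<open>P\<close> are too small to contain a coloured set, so the first
  added element decides the sign. Afterwards the sign can change only when the side that is behind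
  overtakes, because enlarging the leading side preserves its lead. The four successive largest
  colours increase strictly between 1 and 4, so they are 1, 2, 3, 4.\<close>

lemma flag_sign_sequence:
  assumes fin: "finite P" and inj: "inj_on fst P" and cardP: "card (side True P) = m" "card (side False P) = m"
    and s: "distinct [s1, s2, s3, s4]" "{s1, s2, s3, s4} \<inter> fst ` P = {}"
    and sub: "{s1, s2, s3, s4} \<union> fst ` P \<subseteq> {1..2*m+4}"
  shows "flag_sign (insert (s1, b1) P) \<and> \<not> flag_sign (insert (s2, b2) (insert (s1, b1) P)) \<and>
      flag_sign (insert (s3, b3) (insert (s2, b2) (insert (s1, b1) P))) \<and>
      \<not> flag_sign (insert (s4, b4) (insert (s3, b3) (insert (s2, b2) (insert (s1, b1) P)))) \<longleftrightarrow>
    b1 \<and> \<not> b2 \<and> b3 \<and> \<not> b4 \<and>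
      colour (insert s1 (side True P)) = 1 \<and> colour (insert s2 (side False P)) = 2 \<and>
      maxcol (insert s3 (insert s1 (side True P))) = 3 \<and> maxcol (insert s4 (insert s2 (side False P))) = 4"
    (is "?L \<longleftrightarrow> ?R")
proof -
  define A where "A = side True P"
  define B where "B = side False P"
  have AB: "finite A" "finite B" "card A = m" "card B = m" "A \<subseteq> fst ` P" "B \<subseteq> fst ` P"
    using cardP fin finite_side side_subset_fst by (auto simp: A_def B_def)
  have cP: "card P = 2*m" using card_sides[OF fin, of True] cardP by simp
  have nin: "(s, b) \<notin> P" if "s \<in> {s1, s2, s3, s4}" for s b using s(2) that by force
  have c1: "card (insert (s1, b1) P) = 2*m+1" using nin fin cP by simp
  have c2: "card (insert (s2, b2) (insert (s1, b1) P)) = 2*m+2" using nin fin cP s(1) by simp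
  have c3: "card (insert (s3, b3) (insert (s2, b2) (insert (s1, b1) P))) = 2*m+3" using nin fin cP s(1) by simp
  have c4: "card (insert (s4, b4) (insert (s3, b3) (insert (s2, b2) (insert (s1, b1) P)))) = 2*m+4"
    using nin fin cP s(1) by simp
  have sA: "s \<notin> A" "s \<notin> B" if "s \<in> {s1, s2, s3, s4}" for s using that AB s(2) by auto
  have t0: "maxcol A = 0" "maxcol B = 0" using AB by (auto intro: top_colour_small)
  have one: "maxcol (insert s A) = colour (insert s A)" "maxcol (insert s B) = colour (insert s B)"
    if "s \<in> {s1, s2, s3, s4}" for s
    using that sA[OF that] AB by (auto intro!: top_colour_exact)
  have AB0: "A \<inter> B = {}" using side_disjoint[OF inj, of True] by (simp add: A_def B_def)
  have bd: "{s1, s2, s3, s4} \<union> A \<union> B \<subseteq> {1..2*m+4}"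
    using AB(5,6) sub by blast
  have bd': "insert s A \<subseteq> {1..2*m+4}" "insert s B \<subseteq> {1..2*m+4}"
      "insert s (insert t A) \<subseteq> {1..2*m+4}" "insert s (insert t B) \<subseteq> {1..2*m+4}"
    if "s \<in> {s1, s2, s3, s4}" "t \<in> {s1, s2, s3, s4}" for s t
    using bd that by blast+
  have cA: "card (insert s A) = Suc m" "card (insert s B) = Suc m" if "s \<in> {s1, s2, s3, s4}" for s
    using sA[OF that] AB by simp_all
  have pos: "0 < maxcol (insert s A)" "0 < maxcol (insert s B)" if "s \<in> {s1, s2, s3, s4}" for s
    using maxcol_pos[OF bd'(1)[OF that that]] maxcol_pos[OF bd'(2)[OF that that]] cA[OF that] by simp_all
  have mono: "maxcol X \<le> maxcol (insert s X)" if "finite X" for X s using that by (intro top_colour_mono) auto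
  have four: "maxcol (insert s4 (insert s2 B)) \<le> 4" by (intro maxcol_le_4 bd'(4)) simp_all
  have "?L \<longleftrightarrow> b1 \<and> \<not> b2 \<and> b3 \<and> \<not> b4 \<and> maxcol (insert s1 A) < maxcol (insert s2 B) \<and>
      maxcol (insert s2 B) < maxcol (insert s3 (insert s1 A)) \<and>
      maxcol (insert s3 (insert s1 A)) < maxcol (insert s4 (insert s2 B))"
    (is "_ \<longleftrightarrow> ?M")
  proof
    assume ?L
    then have l1: "flag_sign (insert (s1, b1) P)"
      and l2: "\<not> flag_sign (insert (s2, b2) (insert (s1, b1) P))"
      and l3: "flag_sign (insert (s3, b3) (insert (s2, b2) (insert (s1, b1) P)))"
      and l4: "\<not> flag_sign (insert (s4, b4) (insert (s3, b3) (insert (s2, b2) (insert (s1, b1) P))))"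
      by auto
    have b1: "b1"
      using l1 c1 t0 by (cases b1) (auto simp: flag_sign_def side_insert A_def B_def)
    \<comment> \<open>Placing \<open>s2\<close> on the positive side too would leave the negative
      side with value 0.\<close>
    have b2: "\<not> b2"
    proof
      assume "b2"
      then have "\<not> 0 < maxcol (insert s2 (insert s1 A))"
        using l2 c2 t0 b1 by (auto simp: flag_sign_def side_insert A_def B_def)
      then show False using pos(1)[of s1] mono[of "insert s1 A" s2] AB by simp
    qed
    have "maxcol (insert s1 A) \<le> maxcol (insert s2 B)"
      using l2 c2 b1 b2 by (simp add: flag_sign_def side_insert A_def B_def)
    moreover have "maxcol (insert s1 A) \<noteq> maxcol (insert s2 B)"
    proof (rule maxcol_neq)
      show "insert s1 A \<inter> insert s2 B = {}" using AB0 s(1) sA[of s1] sA[of s2] by auto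
      show "insert s1 A \<subseteq> {1..2*m+4}" "insert s2 B \<subseteq> {1..2*m+4}" by (rule bd'(1,2)[of _ s1]; simp)+
    qed (simp add: cA)
    ultimately have lt2: "maxcol (insert s1 A) < maxcol (insert s2 B)" by simp
    have b3: "b3"
      using l3 c3 b1 b2 lt2 mono[of "insert s2 B" s3] AB
      by (cases b3) (auto simp: flag_sign_def side_insert A_def B_def)
    have lt3: "maxcol (insert s2 B) < maxcol (insert s3 (insert s1 A))"
      using l3 c3 b1 b2 b3 by (simp add: flag_sign_def side_insert A_def B_def)
    have b4: "\<not> b4"
      using l4 c4 b1 b2 b3 lt3 mono[of "insert s3 (insert s1 A)" s4] AB
      by (cases b4) (auto simp: flag_sign_def side_insert A_def B_def)
    have "maxcol (insert s3 (insert s1 A)) \<le> maxcol (insert s4 (insert s2 B))"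
      using l4 c4 b1 b2 b3 b4 by (simp add: flag_sign_def side_insert A_def B_def)
    moreover have "maxcol (insert s3 (insert s1 A)) \<noteq> maxcol (insert s4 (insert s2 B))"
    proof (rule maxcol_neq)
      show "insert s3 (insert s1 A) \<inter> insert s4 (insert s2 B) = {}"
        using AB0 s(1) sA[of s1] sA[of s2] sA[of s3] sA[of s4] by auto
      show "insert s3 (insert s1 A) \<subseteq> {1..2*m+4}" "insert s4 (insert s2 B) \<subseteq> {1..2*m+4}"
        by (rule bd'(3,4); simp)+
      show "Suc m \<le> card (insert s3 (insert s1 A))" using sA[of s3] s(1) AB(1) cA[of s1] by simp
    qed
    ultimately show ?M using b1 b2 b3 b4 lt2 lt3 by simp
  next
    assume ?M
    then have M: "b1" "\<not> b2" "b3" "\<not> b4" "maxcol (insert s1 A) < maxcol (insert s2 B)"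
      "maxcol (insert s2 B) < maxcol (insert s3 (insert s1 A))"
      "maxcol (insert s3 (insert s1 A)) < maxcol (insert s4 (insert s2 B))" by blast+
    show ?L
    proof (intro conjI)
      show "flag_sign (insert (s1, b1) P)"
        using M(1) c1 t0 pos(1)[of s1] by (simp add: flag_sign_def side_insert flip: A_def B_def)
      show "\<not> flag_sign (insert (s2, b2) (insert (s1, b1) P))"
        using M(1,2,5) c2 by (simp add: flag_sign_def side_insert flip: A_def B_def)
      show "flag_sign (insert (s3, b3) (insert (s2, b2) (insert (s1, b1) P)))"
        using M(1,2,3,6) c3 by (simp add: flag_sign_def side_insert flip: A_def B_def)
      show "\<not> flag_sign (insert (s4, b4) (insert (s3, b3) (insert (s2, b2) (insert (s1, b1) P))))"
        using M(1,2,3,4,7) c4 by (simp add: flag_sign_def side_insert flip: A_def B_def)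
    qed
  qed
  also have "?M \<longleftrightarrow> b1 \<and> \<not> b2 \<and> b3 \<and> \<not> b4 \<and> maxcol (insert s1 A) = 1 \<and> maxcol (insert s2 B) = 2 \<and>
      maxcol (insert s3 (insert s1 A)) = 3 \<and> maxcol (insert s4 (insert s2 B)) = 4"
    using four pos(1)[of s1] by auto
  also have "\<dots> \<longleftrightarrow> ?R" using one(1)[of s1] one(2)[of s2] by (simp add: A_def B_def)
  finally show ?thesis .
qed

section \<open>The first \<open>2*m\<close> and the last four entries of an alternating flag\<close>

lemma alternating_prefix_signs:
  assumes xs: "xs \<in> alternating_flags flag_sign (2*m+4)" and i: "i < 2*m"
  shows "snd (xs ! i) = even i"
proof -
  have fl: "xs \<in> signed_flags (2*m+4)" and l: "length xs = 2*m+4"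
    using xs length_signed_flag by (auto simp: alternating_flags_def)
  have d: "distinct xs" using fl by (auto simp: signed_flags_def distinct_map)
  have card: "card (set (take j xs)) = j" if "j \<le> 2*m" for j
    using that l d distinct_card[of "take j xs"] by simp
  have sgn: "min_sign (set (take (Suc j) xs)) = even j" if "j < 2*m" for j
  proof -
    have "flag_sign (set (take (Suc j) xs)) = even j"
      using xs that by (simp add: alternating_flags_def)
    then show ?thesis using card[of "Suc j"] that by (simp add: flag_sign_def)
  qed
  have st: "set (take (Suc i) xs) = insert (fst (xs ! i), snd (xs ! i)) (set (take i xs))"
    using set_take_Suc[of i xs] l i by simp
  show ?thesis
  proof (cases i)
    case 0
    then show ?thesis using sgn[OF i] st by (cases "xs ! 0") (simp add: min_sign_def)
  next
    case (Suc j)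
    have "min_sign (set (take i xs)) = even j" using sgn[of j] Suc i by simp
    then have "min_sign (set (take (Suc i) xs)) \<noteq> min_sign (set (take i xs))"
      using sgn[OF i] Suc by simp
    then have "min_sign (set (take (Suc i) xs)) = snd (xs ! i)"
      unfolding st by (intro min_sign_insert) (use flag_nth_fresh[OF fl, of i] i in auto)
    then show ?thesis using sgn[OF i] by simp
  qed
qed

lemma card_side_alternating_prefix:
  assumes xs: "xs \<in> alternating_flags flag_sign (2*m+4)" and "j \<le> m"
  shows "card (side b (set (take (2*j) xs))) = j"
  using assms(2)
proof (induction j)
  case 0
  then show ?case by (simp add: side_empty)
next
  case (Suc j)
  have fl: "xs \<in> signed_flags (2*m+4)" and l: "length xs = 2*m+4"
    using xs length_signed_flag by (auto simp: alternating_flags_def)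
  let ?x = "set (take (2*j) xs)"
  define a where "a = fst (xs ! (2*j))"
  define a' where "a' = fst (xs ! Suc (2*j))"
  have e: "xs ! (2*j) = (a, True)" "xs ! Suc (2*j) = (a', False)"
    using alternating_prefix_signs[OF xs, of "2*j"] alternating_prefix_signs[OF xs, of "Suc (2*j)"] Suc.prems
    by (simp_all add: a_def a'_def prod_eq_iff)
  have 1: "set (take (Suc (2*j)) xs) = insert (a, True) ?x"
    using set_take_Suc[of "2*j" xs] e l Suc.prems by simp
  have 2: "set (take (2 * Suc j) xs) = insert (a', False) (insert (a, True) ?x)"
    using set_take_Suc[of "Suc (2*j)" xs] e 1 l Suc.prems by simp
  have "a \<notin> fst ` ?x" using flag_nth_fresh[OF fl, of "2*j"] Suc.prems by (simp add: a_def)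
  moreover have "a' \<notin> fst ` set (take (Suc (2*j)) xs)"
    using flag_nth_fresh[OF fl, of "Suc (2*j)"] Suc.prems by (simp add: a'_def)
  then have "a' \<notin> fst ` ?x" by (simp add: 1)
  ultimately have "a \<notin> side b ?x" "a' \<notin> side b ?x" using side_subset_fst[of b ?x] by auto
  moreover have "finite (side b ?x)" by (simp add: finite_side)
  ultimately show ?case unfolding 2 using Suc by (cases b) (simp_all add: side_insert)
qed

text \<open>Exchanging \<open>w\<close> with \<open>y\<close>, or \<open>x\<close> with
  \<open>z\<close>, preserves the sets \<open>insert y (insert w A)\<close> and
  \<open>insert z (insert x B)\<close> and hence both \<open>maxcol\<close> conditions. The orders
  that survive the pairing are handled by \<open>even_card_rainbow_orders\<close>, with
  \<open>F s = f (insert s A)\<close> and \<open>G s = f (insert s B)\<close>.\<close>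

lemma even_card_orders:
  assumes AB: "A \<subseteq> {1..2*m+4}" "B \<subseteq> {1..2*m+4}" "card A = m" "card B = m" "A \<inter> B = {}"
    and S: "S \<subseteq> {1..2*m+4}" "S \<inter> A = {}" "S \<inter> B = {}" "card S = 4"
  shows "even (card {(w, x, y, z). distinct [w, x, y, z] \<and> {w, x, y, z} \<subseteq> S \<and>
      colour (insert w A) = 1 \<and> colour (insert x B) = 2 \<and>
      maxcol (insert y (insert w A)) = 3 \<and> maxcol (insert z (insert x B)) = 4})" (is "even (card ?W)")
proof -
  \<comment> \<open>The fixed points of this involution are the orders in which the colours 3 and 4 are
    already attained by \<open>insert y A\<close> and \<open>insert z B\<close>.\<close>
  define g where "g = (\<lambda>(w, x, y, z).
    if colour (insert y A) = 1 then (y, x, w, z)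
    else if colour (insert z B) = 2 then (w, z, y, x) else (w, x, y, z))"
  have fin: "finite A" "finite B" "finite S" using AB S finite_subset by blast+
  have vA: "insert s A \<subseteq> {1..2*m+4}" "card (insert s A) = Suc m"
    and vB: "insert s B \<subseteq> {1..2*m+4}" "card (insert s B) = Suc m" if "s \<in> S" for s
  proof -
    have "s \<notin> A" "s \<notin> B" "s \<in> {1..2*m+4}" using that S by blast+
    then show "insert s A \<subseteq> {1..2*m+4}" "card (insert s A) = Suc m"
      "insert s B \<subseteq> {1..2*m+4}" "card (insert s B) = Suc m" using AB(1-4) fin by simp_all
  qed
  have disj: "insert s A \<inter> insert t B = {}" if "s \<in> S" "t \<in> S" "s \<noteq> t" for s t
    using that AB(5) S(2,3) by blast
  have neq: "colour (insert s A) \<noteq> colour (insert t B)" if "s \<in> S" "t \<in> S" "s \<noteq> t" for s t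
    using that colour_neq[OF vA vB disj] by blast
  have finW: "finite ?W"
    by (rule finite_subset[of _ "S \<times> S \<times> S \<times> S"]) (use fin in auto)
  have inv: "g q \<in> ?W \<and> g (g q) = q" if "q \<in> ?W" for q
  proof -
    obtain w x y z where q_eq: "q = (w, x, y, z)" by (cases q)
    have h: "distinct [w, x, y, z]" "w \<in> S" "x \<in> S" "y \<in> S" "z \<in> S"
      "colour (insert w A) = 1" "colour (insert x B) = 2"
      "maxcol (insert y (insert w A)) = 3" "maxcol (insert z (insert x B)) = 4"
      "maxcol (insert w (insert y A)) = 3" "maxcol (insert x (insert z B)) = 4"
      using that unfolding q_eq by (simp_all add: insert_commute)
    consider "colour (insert y A) = 1" | "colour (insert y A) \<noteq> 1" "colour (insert z B) = 2"
      | "colour (insert y A) \<noteq> 1" "colour (insert z B) \<noteq> 2" by blast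
    then show ?thesis by cases (use h in \<open>auto simp: g_def q_eq\<close>)
  qed
  have "even (card ?W) \<longleftrightarrow> even (card {q \<in> ?W. g q = q})"
    by (rule even_card_iff_even_card_fixpoints[OF finW inv[THEN conjunct1] inv[THEN conjunct2]])
  also have "{q \<in> ?W. g q = q} = {(w, x, y, z). distinct [w, x, y, z] \<and> {w, x, y, z} \<subseteq> S \<and>
      colour (insert w A) = 1 \<and> colour (insert x B) = 2 \<and>
      colour (insert y A) = 3 \<and> colour (insert z B) = 4}" (is "_ = ?V")
  proof (intro equalityI subsetI)
    fix q assume q: "q \<in> {q \<in> ?W. g q = q}"
    obtain w x y z where q_eq: "q = (w, x, y, z)" by (cases q)
    have h: "distinct [w, x, y, z]" "w \<in> S" "x \<in> S" "y \<in> S" "z \<in> S"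
      "colour (insert w A) = 1" "colour (insert x B) = 2"
      "maxcol (insert y (insert w A)) = 3" "maxcol (insert z (insert x B)) = 4"
      and gq: "g (w, x, y, z) = (w, x, y, z)"
      using q unfolding q_eq by simp_all
    have y1: "colour (insert y A) \<noteq> 1" and z2: "colour (insert z B) \<noteq> 2"
      using gq h(1) by (auto simp: g_def split: if_splits)
    \<comment> \<open>Disjoint sets exclude colours: \<open>insert x B\<close> rules out 2 for
      \<open>insert y A\<close>, and then \<open>insert w A\<close> and \<open>insert y A\<close>
      rule out 1 and 3 for \<open>insert z B\<close>.\<close>
    have "colour (insert y A) \<le> maxcol (insert y (insert w A))"
      using vA[OF h(4)] fin by (intro top_colour_ge) auto
    moreover have "colour (insert y A) \<noteq> 2" using neq[of y x] h by auto
    moreover have "1 \<le> colour (insert y A)" using colour_range(2)[OF vA[OF h(4)]] .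
    ultimately have y3: "colour (insert y A) = 3" using y1 h(8) by linarith
    have "colour (insert z B) \<noteq> 1" using neq[of w z] h by auto
    moreover have "colour (insert z B) \<noteq> 3" using neq[of y z] h y3 by auto
    moreover have "1 \<le> colour (insert z B)" "colour (insert z B) \<le> 4" using colour_range(2,3)[OF vB[OF h(5)]] .
    ultimately have "colour (insert z B) = 4" using z2 by linarith
    then show "q \<in> ?V" using h y3 by (simp add: q_eq)
  next
    fix q assume q: "q \<in> ?V"
    obtain w x y z where q_eq: "q = (w, x, y, z)" by (cases q)
    have h: "distinct [w, x, y, z]" "w \<in> S" "x \<in> S" "y \<in> S" "z \<in> S"
      "colour (insert w A) = 1" "colour (insert x B) = 2"
      "colour (insert y A) = 3" "colour (insert z B) = 4"
      using q unfolding q_eq by simp_all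
    have finA: "finite (insert y (insert w A))" and finB: "finite (insert z (insert x B))" using fin by auto
    have sub: "insert y (insert w A) \<subseteq> {1..2*m+4}" "insert z (insert x B) \<subseteq> {1..2*m+4}"
      using h(2-5) AB S by auto
    have gey: "3 \<le> maxcol (insert y (insert w A))"
      using top_colour_ge[OF finA, of "insert y A" "Suc m" colour] vA[OF h(4)] h(8) by auto
    have gez: "4 \<le> maxcol (insert z (insert x B))"
      using top_colour_ge[OF finB, of "insert z B" "Suc m" colour] vB[OF h(5)] h(9) by auto
    have z4: "maxcol (insert z (insert x B)) = 4" using gez maxcol_le_4[OF sub(2)] by simp
    \<comment> \<open>The value on the \<open>A\<close> side is at least 3, and 4 is already taken
      by a disjoint set.\<close>
    have "maxcol (insert z (insert x B)) \<noteq> maxcol (insert y (insert w A))"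
    proof (rule maxcol_neq)
      show "insert z (insert x B) \<inter> insert y (insert w A) = {}" using h(1-5) AB(5) S(2,3) by auto
      have "card (insert z B) \<le> card (insert z (insert x B))" using finB by (intro card_mono) auto
      then show "Suc m \<le> card (insert z (insert x B))" using vB[OF h(5)] by simp
    qed (use sub in blast)+
    then have "maxcol (insert y (insert w A)) = 3" using gey z4 maxcol_le_4[OF sub(1)] by linarith
    moreover have "g (w, x, y, z) = (w, x, y, z)" using h(8,9) by (simp add: g_def)
    ultimately show "q \<in> {q \<in> ?W. g q = q}" using h z4 by (simp add: q_eq)
  qed
  also have "even (card ?V)"
  proof (rule even_card_rainbow_orders[OF S(4)])
    fix s assume "s \<in> S"
    then show "f (insert s A) \<in> shift_vertices 4" "f (insert s B) \<in> shift_vertices 4"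
      using colour_range(1)[OF vA] colour_range(1)[OF vB] by blast+
  next
    fix s t assume "s \<in> S" "t \<in> S" "s \<noteq> t"
    then show "shift_adj (f (insert s A)) (f (insert t B))" using f_adj[OF vA vB disj] by blast
  qed
  finally show ?thesis .
qed

text \<open>The signs along \<open>p\<close> are given by \<open>alt\<close>, so only the last four
  members matter, and \<open>flag_sign_sequence\<close> describes these. As \<open>S\<close> has
  exactly four elements, four distinct ones complete \<open>p\<close> to a flag.\<close>

lemma flag_fibre:
  fixes p :: "(nat \<times> bool) list"
  assumes p: "distinct (map fst p)" "fst ` set p \<subseteq> {1..2*m+4}" "length p = 2*m"
    and cards: "\<And>b. card (side b (set p)) = m"
    and alt: "\<forall>i<2*m. flag_sign (set (take (Suc i) p)) = even i"
  defines "S \<equiv> {1..2*m+4} - fst ` set p"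
  shows "p @ [(s1, b1), (s2, b2), (s3, b3), (s4, b4)] \<in> alternating_flags flag_sign (2*m+4) \<longleftrightarrow>
    (b1 \<and> \<not> b2 \<and> b3 \<and> \<not> b4) \<and> distinct [s1, s2, s3, s4] \<and> {s1, s2, s3, s4} \<subseteq> S \<and>
      colour (insert s1 (side True (set p))) = 1 \<and> colour (insert s2 (side False (set p))) = 2 \<and>
      maxcol (insert s3 (insert s1 (side True (set p)))) = 3 \<and>
      maxcol (insert s4 (insert s2 (side False (set p)))) = 4"
    (is "?xs \<in> _ \<longleftrightarrow> _")
proof -
  have cardS: "card S = 4"
    unfolding S_def using p distinct_card[of "map fst p"] by (subst card_Diff_subset) auto
  have flags: "?xs \<in> signed_flags (2*m+4) \<longleftrightarrow> distinct [s1, s2, s3, s4] \<and> {s1, s2, s3, s4} \<subseteq> S"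
  proof
    assume "?xs \<in> signed_flags (2*m+4)"
    then have "distinct (map fst ?xs)" and img: "fst ` set ?xs = {1..2*m+4}"
      by (simp_all only: signed_flags_def mem_Collect_eq)
    then have "distinct [s1, s2, s3, s4]" "{s1, s2, s3, s4} \<inter> fst ` set p = {}" by auto
    moreover have "{s1, s2, s3, s4} \<subseteq> {1..2*m+4}" unfolding img[symmetric] by auto
    ultimately show "distinct [s1, s2, s3, s4] \<and> {s1, s2, s3, s4} \<subseteq> S" unfolding S_def by blast
  next
    assume *: "distinct [s1, s2, s3, s4] \<and> {s1, s2, s3, s4} \<subseteq> S"
    have "{s1, s2, s3, s4} = S"
      by (rule card_subset_eq) (use * cardS in \<open>auto simp: S_def\<close>)
    then have "fst ` set ?xs = {1..2*m+4}" using p(2) by (auto simp: S_def)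
    moreover have "distinct (map fst ?xs)" using p(1) * by (auto simp: S_def)
    ultimately show "?xs \<in> signed_flags (2*m+4)" by (simp only: signed_flags_def mem_Collect_eq simp_thms)
  qed
  have split: "(\<forall>i<2*m+4. Q i) \<longleftrightarrow> (\<forall>i<2*m. Q i) \<and> Q (2*m) \<and> Q (2*m+1) \<and> Q (2*m+2) \<and> Q (2*m+3)" for Q
    by (auto simp: less_Suc_eq numeral_eq_Suc)
  have sets: "set (take (Suc (2*m)) ?xs) = insert (s1, b1) (set p)"
    "set (take (Suc (2*m+1)) ?xs) = insert (s2, b2) (insert (s1, b1) (set p))"
    "set (take (Suc (2*m+2)) ?xs) = insert (s3, b3) (insert (s2, b2) (insert (s1, b1) (set p)))"
    "set (take (Suc (2*m+3)) ?xs) = insert (s4, b4) (insert (s3, b3) (insert (s2, b2) (insert (s1, b1) (set p))))"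
    using p(3) by (auto simp: numeral_eq_Suc)
  have pre: "take (Suc i) ?xs = take (Suc i) p" if "i < 2*m" for i using that p(3) by simp
  have "(\<forall>i<2*m+4. flag_sign (set (take (Suc i) ?xs)) = even i) \<longleftrightarrow>
      flag_sign (insert (s1, b1) (set p)) \<and> \<not> flag_sign (insert (s2, b2) (insert (s1, b1) (set p))) \<and>
      flag_sign (insert (s3, b3) (insert (s2, b2) (insert (s1, b1) (set p)))) \<and>
      \<not> flag_sign (insert (s4, b4) (insert (s3, b3) (insert (s2, b2) (insert (s1, b1) (set p)))))"
    unfolding split sets using alt by (simp add: pre del: take_append take_Suc)
  also have "\<dots> \<longleftrightarrow> b1 \<and> \<not> b2 \<and> b3 \<and> \<not> b4 \<and>
      colour (insert s1 (side True (set p))) = 1 \<and> colour (insert s2 (side False (set p))) = 2 \<and>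
      maxcol (insert s3 (insert s1 (side True (set p)))) = 3 \<and>
      maxcol (insert s4 (insert s2 (side False (set p)))) = 4"
    if "distinct [s1, s2, s3, s4]" "{s1, s2, s3, s4} \<subseteq> S"
  proof (rule flag_sign_sequence)
    show "inj_on fst (set p)" using p(1) by (simp add: distinct_map)
    show "{s1, s2, s3, s4} \<inter> fst ` set p = {}" using that(2) by (auto simp: S_def)
    show "{s1, s2, s3, s4} \<union> fst ` set p \<subseteq> {1..2*m+4}" using that(2) p(2) by (auto simp: S_def)
  qed (use cards that(1) in simp_all)
  finally show ?thesis
    unfolding alternating_flags_def mem_Collect_eq flags by blast
qed

theorem no_hom: False
proof -
  let ?X = "alternating_flags flag_sign (2*m+4)"
  have "even (card ?X)"
  \<comment> \<open>The first \<open>2*m\<close> entries determine the disjoint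
    \<open>m\<close>-sets on the two sides, so each fibre is in bijection with the orders counted in
    \<open>even_card_orders\<close>.\<close>
  proof (rule even_card_if_even_fibres[where h = "take (2*m)"])
    show "finite ?X" using finite_signed_flags by (simp add: alternating_flags_def)
  next
    fix p assume "p \<in> take (2*m) ` ?X"
    then obtain xs where xs: "xs \<in> ?X" and p: "p = take (2*m) xs" by blast
    have fl: "xs \<in> signed_flags (2*m+4)" and l: "length xs = 2*m+4"
      using xs length_signed_flag by (auto simp: alternating_flags_def)
    have p1: "distinct (map fst p)" "fst ` set p \<subseteq> {1..2*m+4}" "length p = 2*m"
      using fl l set_take_subset[of "2*m" xs]
      by (auto simp: p signed_flags_def distinct_take simp flip: take_map)
    have cards: "card (side b (set p)) = m" for b
      using card_side_alternating_prefix[OF xs, of m b] by (simp add: p)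
    have alt: "\<forall>i<2*m. flag_sign (set (take (Suc i) p)) = even i"
      using xs by (simp add: alternating_flags_def p min_def)
    define S where "S = {1..2*m+4} - fst ` set p"
    let ?W = "{(w, x, y, z). distinct [w, x, y, z] \<and> {w, x, y, z} \<subseteq> S \<and>
      colour (insert w (side True (set p))) = 1 \<and> colour (insert x (side False (set p))) = 2 \<and>
      maxcol (insert y (insert w (side True (set p)))) = 3 \<and> maxcol (insert z (insert x (side False (set p)))) = 4}"
    let ?e = "\<lambda>(w, x, y, z). p @ [(w, True), (x, False), (y, True), (z, False)]"
    note fibre = flag_fibre[OF p1 cards alt, folded S_def]
    have "{xs \<in> ?X. take (2*m) xs = p} = ?e ` ?W"
    proof (intro equalityI subsetI)
      fix ys assume "ys \<in> {xs \<in> ?X. take (2*m) xs = p}"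
      then have ys: "ys \<in> ?X" "take (2*m) ys = p" by simp_all
      then have ly: "length ys = 2*m+4" using length_signed_flag by (auto simp: alternating_flags_def)
      then have "length (drop (2*m) ys) = Suc (Suc (Suc (Suc 0)))" by simp
      then obtain e1 e2 e3 e4 where "drop (2*m) ys = [e1, e2, e3, e4]"
        unfolding length_Suc_conv length_0_conv by blast
      moreover obtain s1 b1 where "e1 = (s1, b1)" by (cases e1)
      moreover obtain s2 b2 where "e2 = (s2, b2)" by (cases e2)
      moreover obtain s3 b3 where "e3 = (s3, b3)" by (cases e3)
      moreover obtain s4 b4 where "e4 = (s4, b4)" by (cases e4)
      ultimately have "ys = p @ [(s1, b1), (s2, b2), (s3, b3), (s4, b4)]"
        using append_take_drop_id[of "2*m" ys] ys(2) by simp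
      then show "ys \<in> ?e ` ?W" using ys(1) fibre by (auto intro!: image_eqI[of _ _ "(s1, s2, s3, s4)"])
    next
      fix ys assume "ys \<in> ?e ` ?W"
      then obtain w x y z where q: "(w, x, y, z) \<in> ?W"
        and ys: "ys = p @ [(w, True), (x, False), (y, True), (z, False)]" by auto
      have "ys \<in> ?X" unfolding ys fibre using q by simp
      then show "ys \<in> {xs \<in> ?X. take (2*m) xs = p}" using p1(3) ys by simp
    qed
    moreover have "inj_on ?e ?W" by (auto simp: inj_on_def)
    ultimately have "card {xs \<in> ?X. take (2*m) xs = p} = card ?W" by (simp only: card_image)
    also have "even (card ?W)"
    proof (rule even_card_orders)
      show "side True (set p) \<subseteq> {1..2*m+4}" "side False (set p) \<subseteq> {1..2*m+4}"
        "S \<inter> side True (set p) = {}" "S \<inter> side False (set p) = {}"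
        using side_subset_fst[of _ "set p"] p1(2) by (auto simp: S_def)
      show "side True (set p) \<inter> side False (set p) = {}"
        using side_disjoint[of "set p" True] p1(1) by (simp add: distinct_map)
      show "card S = 4"
        unfolding S_def using p1 distinct_card[of "map fst p"] by (subst card_Diff_subset) auto
    qed (use cards in \<open>auto simp: S_def\<close>)
    finally show "even (card {xs \<in> ?X. take (2*m) xs = p})" .
  qed
  then show False using odd_card_alternating_flags[OF antipodal_flag_sign] by blast
qed

end

theorem mainTheorem3:
  shows "(\<forall>k::nat. k \<ge> 2 \<longrightarrow>
            (\<exists>f. graph_hom (schrijver_vertices (2*k+2) k) kneser_adj
                              (shift_vertices 4) shift_adj f))
       \<and> (\<forall>k::nat. k \<ge> 1 \<longrightarrow>
            \<not> (\<exists>f. graph_hom (kneser_vertices (2*k+2) k) kneser_adj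
                              (shift_vertices 4) shift_adj f))"
proof (intro conjI allI impI notI)
  fix k :: nat assume "k \<ge> 1" and "\<exists>f. graph_hom (kneser_vertices (2*k+2) k) kneser_adj
      (shift_vertices 4) shift_adj f"
  moreover obtain m where "k = Suc m" using \<open>k \<ge> 1\<close> by (cases k) auto
  moreover have "2 * Suc m + 2 = 2 * m + 4" by simp
  ultimately obtain f where
    "graph_hom (kneser_vertices (2*m+4) (Suc m)) kneser_adj (shift_vertices 4) shift_adj f" by metis
  then interpret kneser_shift_hom m f by unfold_locales
  show False by (rule no_hom)
qed (rule ex_hom_schrijver_shift)

end
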